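(* Let $\mathbf A$ be an algebra with a Mal'cev term $q$, let $n\ge1$, and let $\alpha_0,\dots,\alpha_{n-1}$ be congruences of $\mathbf A$. Then there exists a largest clone $\mathcal C$ on $A$ such that: $q\in\mathcal C$; every operation of $\mathcal C$ preserves each of $\alpha_0,\dots,\alpha_{n-1}$; and for every nonempty $I\subseteq\{0,\dots,n-1\}$ the commutator $[\alpha_i\mid i\in I]$ computed in $\mathbf A$ equals the commutator $[\alpha_i\mid i\in I]$ computed in the algebra $(A,\mathcal C)$. (In fact $\mathcal C$ is the clone of all polymorphisms of the relation $\Delta_{\mathbf A}(\alpha_0,\dots,\alpha_{n-1})$.)
   Context: A Mal'cev term of $\mathbf A$ is a ternary term operation $q$ with $q(x,x,y)=y=q(y,x,x)$ for all $x,y$. For a clone $\mathcal C$ on $A$, $(A,\mathcal C)$ denotes the algebra whose basic (equivalently, term) operations are those of $\mathcal C$. Higher commutator (Bulatov): for congruences $\alpha_0,\dots,\alpha_{m-1},\gamma$ of an algebra, say $\alpha_0,\dots,\alpha_{m-2}$ centralize $\alpha_{m-1}$ modulo $\gamma$ if for all tuples $\mathbf a_i,\mathbf b_i$ ($i<m$, with $\mathbf a_i\neq\mathbf b_i$ congruent modulo $\alpha_i$ coordinatewise) and every term operation $t$ such that $t(\mathbf x_0,\dots,\mathbf x_{m-2},\mathbf a_{m-1})\equiv_\gamma t(\mathbf x_0,\dots,\mathbf x_{m-2},\mathbf b_{m-1})$ for all $(\mathbf x_0,\dots,\mathbf x_{m-2})\in(\{\mathbf a_0,\mathbf b_0\}\times\dots\times\{\mathbf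 a_{m-2},\mathbf b_{m-2}\})\setminus\{(\mathbf b_0,\dots,\mathbf b_{m-2})\}$, we have $t(\mathbf b_0,\dots,\mathbf b_{m-2},\mathbf a_{m-1})\equiv_\gamma t(\mathbf b_0,\dots,\mathbf b_{m-2},\mathbf b_{m-1})$. The commutator $[\alpha_0,\dots,\alpha_{m-1}]$ is the smallest congruence $\gamma$ such that $\alpha_0,\dots,\alpha_{m-2}$ centralize $\alpha_{m-1}$ modulo $\gamma$. For $I=\{i_0<\dots<i_{k-1}\}$, $[\alpha_i\mid i\in I]$ means $[\alpha_{i_0},\dots,\alpha_{i_{k-1}}]$. For $k\ge0$, $k_{(i)}$ is the $i$-th binary digit of $k$ (least significant is $i=0$). For $a,b\in A$ and $i<n$, $\mathbf c_i^n(a,b)\in A^{2^n}$ has $k$-th coordinate $a$ if $k_{(i)}=0$ and $b$ if $k_{(i)}=1$. $\Delta_{\mathbf A}(\alpha_0,\dots,\alpha_{n-1})$ is the subuniverse of $\mathbf A^{2^n}$ generated by $\{\mathbf c_i^n(a,b): i<n,\ (a,b)\in\alpha_i\}$. *)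

theory Defs
  imports Main
begin

(* An n-ary operation on A is a pair (n, f) with f :: 'a list => 'a.
   Operations are kept canonical: f is 'undefined' outside A^n, so that
   sets of operations (clones) can be compared by inclusion. *)

type_synonym 'a operation = "nat \<times> ('a list \<Rightarrow> 'a)"

definition op_on :: "'a set \<Rightarrow> nat \<Rightarrow> ('a list \<Rightarrow> 'a) \<Rightarrow> bool" where
  "op_on A n f \<longleftrightarrow>
     (\<forall>xs. length xs = n \<and> set xs \<subseteq> A \<longrightarrow> f xs \<in> A) \<and>
     (\<forall>xs. \<not> (length xs = n \<and> set xs \<subseteq> A) \<longrightarrow> f xs = undefined)"

definition proj :: "'a set \<Rightarrow> nat \<Rightarrow> nat \<Rightarrow> 'a list \<Rightarrow> 'a" where
  "proj A n i = (\<lambda>xs. if length xs = n \<and> set xs \<subseteq> A then xs ! i else undefined)"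

definition compose :: "'a set \<Rightarrow> nat \<Rightarrow> ('a list \<Rightarrow> 'a) \<Rightarrow> ('a list \<Rightarrow> 'a) list \<Rightarrow> 'a list \<Rightarrow> 'a" where
  "compose A n f gs = (\<lambda>xs. if length xs = n \<and> set xs \<subseteq> A then f (map (\<lambda>g. g xs) gs) else undefined)"

definition algebra :: "'a set \<Rightarrow> 'a operation set \<Rightarrow> bool" where
  "algebra A F \<longleftrightarrow> A \<noteq> {} \<and>
     (\<forall>(k, f) \<in> F. \<forall>xs. length xs = k \<and> set xs \<subseteq> A \<longrightarrow> f xs \<in> A)"

inductive_set term_ops :: "'a set \<Rightarrow> 'a operation set \<Rightarrow> 'a operation set"
  for A :: "'a set" and F :: "'a operation set" where
  proj_in: "1 \<le> n \<Longrightarrow> i < n \<Longrightarrow> (n, proj A n i) \<in> term_ops A F"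
| comp_in: "(k, f) \<in> F \<Longrightarrow> length gs = k \<Longrightarrow> 1 \<le> n \<Longrightarrow>
            (\<forall>g \<in> set gs. (n, g) \<in> term_ops A F) \<Longrightarrow> (n, compose A n f gs) \<in> term_ops A F"

definition is_clone :: "'a set \<Rightarrow> 'a operation set \<Rightarrow> bool" where
  "is_clone A C \<longleftrightarrow>
     (\<forall>(n, f) \<in> C. 1 \<le> n \<and> op_on A n f) \<and>
     (\<forall>n i. 1 \<le> n \<and> i < n \<longrightarrow> (n, proj A n i) \<in> C) \<and>
     (\<forall>k f n gs. (k, f) \<in> C \<and> length gs = k \<and> 1 \<le> n \<and> (\<forall>g \<in> set gs. (n, g) \<in> C)
        \<longrightarrow> (n, compose A n f gs) \<in> C)"

definition preserves :: "nat \<Rightarrow> ('a list \<Rightarrow> 'a) \<Rightarrow> ('a \<times> 'a) set \<Rightarrow> bool" where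
  "preserves k f \<theta> \<longleftrightarrow>
     (\<forall>xs ys. length xs = k \<and> length ys = k \<and> list_all2 (\<lambda>x y. (x, y) \<in> \<theta>) xs ys
        \<longrightarrow> (f xs, f ys) \<in> \<theta>)"

definition congruence :: "'a set \<Rightarrow> 'a operation set \<Rightarrow> ('a \<times> 'a) set \<Rightarrow> bool" where
  "congruence A F \<theta> \<longleftrightarrow> equiv A \<theta> \<and> (\<forall>(k, f) \<in> F. preserves k f \<theta>)"

(* Bulatov centrality: \<alpha> 0, ..., \<alpha> (m-2) centralize \<alpha> (m-1) modulo \<gamma> in (A, F).
   Tuple a_i, b_i are lists; the term t has arity sum of their lengths and is applied
   to the concatenation.  A choice function s selects b_i (s i) or a_i (\<not> s i). *)
definition centralizes :: "'a set \<Rightarrow> 'a operation set \<Rightarrow> nat \<Rightarrow> (nat \<Rightarrow> ('a \<times> 'a) set)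
                             \<Rightarrow> ('a \<times> 'a) set \<Rightarrow> bool" where
  "centralizes A F m \<alpha> \<gamma> \<longleftrightarrow>
     (\<forall>N t a b. (N, t) \<in> term_ops A F \<longrightarrow>
        (\<forall>i < m. length (a i) = length (b i) \<and> a i \<noteq> b i \<and>
                  list_all2 (\<lambda>x y. (x, y) \<in> \<alpha> i) (a i) (b i)) \<longrightarrow>
        (\<Sum>i<m. length (a i)) = N \<longrightarrow>
        (\<forall>s :: nat \<Rightarrow> bool. (\<exists>i < m - 1. \<not> s i) \<longrightarrow>
           (t (concat (map (\<lambda>i. if s i then b i else a i) [0..<m - 1]) @ a (m - 1)),
            t (concat (map (\<lambda>i. if s i then b i else a i) [0..<m - 1]) @ b (m - 1))) \<in> \<gamma>) \<longrightarrow>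
        (t (concat (map b [0..<m - 1]) @ a (m - 1)),
         t (concat (map b [0..<m - 1]) @ b (m - 1))) \<in> \<gamma>)"

definition commutator :: "'a set \<Rightarrow> 'a operation set \<Rightarrow> nat \<Rightarrow> (nat \<Rightarrow> ('a \<times> 'a) set)
                            \<Rightarrow> ('a \<times> 'a) set" where
  "commutator A F m \<alpha> = \<Inter> {\<gamma>. congruence A F \<gamma> \<and> centralizes A F m \<alpha> \<gamma>}"

definition commutator_on :: "'a set \<Rightarrow> 'a operation set \<Rightarrow> nat set \<Rightarrow> (nat \<Rightarrow> ('a \<times> 'a) set)
                               \<Rightarrow> ('a \<times> 'a) set" where
  "commutator_on A F I \<alpha> = commutator A F (card I) (\<lambda>j. \<alpha> (sorted_list_of_set I ! j))"

definition ctuple :: "nat \<Rightarrow> nat \<Rightarrow> 'a \<Rightarrow> 'a \<Rightarrow> 'a list" where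
  "ctuple n i a b = map (\<lambda>k. if (k div 2 ^ i) mod 2 = 0 then a else b) [0..<2 ^ n]"

inductive_set Delta :: "'a set \<Rightarrow> 'a operation set \<Rightarrow> nat \<Rightarrow> (nat \<Rightarrow> ('a \<times> 'a) set) \<Rightarrow> 'a list set"
  for A :: "'a set" and F :: "'a operation set" and n :: nat and \<alpha> :: "nat \<Rightarrow> ('a \<times> 'a) set" where
  gen: "i < n \<Longrightarrow> (a, b) \<in> \<alpha> i \<Longrightarrow> ctuple n i a b \<in> Delta A F n \<alpha>"
| app: "(k, f) \<in> F \<Longrightarrow> length vs = k \<Longrightarrow> (\<forall>v \<in> set vs. v \<in> Delta A F n \<alpha>) \<Longrightarrow>
        map (\<lambda>j. f (map (\<lambda>v. v ! j) vs)) [0..<2 ^ n] \<in> Delta A F n \<alpha>"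

definition Pol :: "'a set \<Rightarrow> nat \<Rightarrow> 'a list set \<Rightarrow> 'a operation set" where
  "Pol A n R = {(N, f). 1 \<le> N \<and> op_on A N f \<and>
     (\<forall>vs. length vs = N \<and> set vs \<subseteq> R \<longrightarrow> map (\<lambda>j. f (map (\<lambda>v. v ! j) vs)) [0..<2 ^ n] \<in> R)}"

end

theory Submission
  imports Defs
begin

text \<open>
  Identify the coordinates of \<open>\<Delta>\<close> with the vertices of a cube, that is, with sets of bits.
  The Mal'cev term shows that \<open>(x, y)\<close> lies in the commutator of the \<open>\<alpha> i\<close>, \<open>i \<in> I\<close>, iff the
  fork with value \<open>y\<close> on the vertices containing \<open>I\<close> and \<open>x\<close> elsewhere belongs to \<open>\<Delta>\<close>. Hence \<open>\<Delta>\<close>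
  determines all the commutators. Conversely, two elements of \<open>\<Delta>\<close> agreeing on all proper subsets of
  \<open>I\<close> have values at \<open>I\<close> that differ by a pair in the commutator of \<open>I\<close>, so \<open>\<Delta>\<close> is generated under
  \<open>q\<close> alone by forks, and a clone with the same commutators preserves it.
\<close>

section \<open>Bits of natural numbers\<close>

text \<open>The vertex of the \<open>n\<close>-cube whose bits are prescribed by \<open>P\<close>.
  The maps between cubes and faces below are mostly defined by prescribing bits in this way.\<close>

definition of_bits :: "nat \<Rightarrow> (nat \<Rightarrow> bool) \<Rightarrow> nat" where
  "of_bits n P = horner_sum of_bool 2 (map P [0..<n])"

lemma bit_of_bits [simp]: "bit (of_bits n P) i \<longleftrightarrow> i < n \<and> P i"
  by (auto simp: of_bits_def bit_horner_sum_bit_iff)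

lemma of_bits_less [simp]: "of_bits n P < 2 ^ n"
proof -
  have "take_bit n (of_bits n P) = of_bits n P"
    by (rule bit_eqI) (auto simp: bit_take_bit_iff)
  then show ?thesis
    by (simp add: take_bit_nat_eq_self_iff)
qed

lemma bit_imp_less_exponent:
  fixes k :: nat
  assumes "k < 2 ^ n" and "bit k i"
  shows "i < n"
  using assms by (metis bit_take_bit_iff take_bit_nat_eq_self)

text \<open>The order of numbers is a linear extension of inclusion of bit sets. Vertices can
  therefore be treated in increasing order: a fork on the bits of \<open>p\<close> takes its second
  value at \<open>p\<close> but not at any smaller vertex.\<close>

lemma bit_subset_imp_le:
  includes bit_operations_syntax
  fixes k l :: nat
  assumes "\<And>i. bit k i \<Longrightarrow> bit l i"
  shows "k \<le> l"
proof -
  have "k = k AND l"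
    by (rule bit_eqI) (use assms in \<open>auto simp: bit_and_iff\<close>)
  moreover have "k AND l \<le> l"
    by (simp add: and_nat_def nat_le_iff)
  ultimately show ?thesis by simp
qed

text \<open>\<open>2 ^ r\<close> and \<open>k\<close> have no bit in common, so adding them is
  taking the union of bit sets. Thus \<open>2 ^ r + k\<close> is the neighbour of \<open>k\<close>
  in direction \<open>r\<close>.\<close>

lemma bit_add_exponent:
  includes bit_operations_syntax
  fixes k :: nat
  assumes "k < 2 ^ r"
  shows "bit (2 ^ r + k) i \<longleftrightarrow> i = r \<or> bit k i"
proof -
  have "2 ^ r AND k = 0"
    by (rule bit_eqI) (use bit_imp_less_exponent[OF assms] in \<open>auto simp: bit_simps\<close>)
  then have "2 ^ r + k = 2 ^ r OR k"
    by (rule disjunctive_add_eq_or)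
  then show ?thesis
    by (auto simp: bit_or_iff bit_exp_iff)
qed

lemma all_bits_iff:
  fixes k :: nat
  assumes "k < 2 ^ n"
  shows "(\<forall>i<n. bit k i) \<longleftrightarrow> k = 2 ^ n - 1"
proof
  assume "\<forall>i<n. bit k i"
  then have "k = mask n"
    by (intro bit_eqI) (use bit_imp_less_exponent[OF assms] in \<open>auto simp: bit_mask_iff\<close>)
  then show "k = 2 ^ n - 1"
    by (simp add: mask_eq_exp_minus_1)
next
  assume "k = 2 ^ n - 1"
  then have "k = mask n"
    by (simp add: mask_eq_exp_minus_1)
  then show "\<forall>i<n. bit k i"
    by (simp add: bit_mask_iff)
qed


section \<open>Term operations\<close>

lemma term_ops_op_on:
  assumes "algebra A F" and "(N, t) \<in> term_ops A F"
  shows "op_on A N t"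
  using assms(2)
proof induction
  case (proj_in n i)
  then show ?case
    by (auto simp: op_on_def proj_def)
next
  case (comp_in k f gs n)
  have "f (map (\<lambda>g. g xs) gs) \<in> A" if "length xs = n" "set xs \<subseteq> A" for xs
  proof -
    have "set (map (\<lambda>g. g xs) gs) \<subseteq> A"
      using comp_in that by (auto simp: op_on_def)
    then show ?thesis
      using assms(1) comp_in(1,2) by (auto simp: algebra_def)
  qed
  then show ?case
    by (auto simp: op_on_def compose_def)
qed

text \<open>Composing \<open>f\<close> with all projections gives \<open>f\<close> back. Canonicity
  of \<open>f\<close> makes the two functions equal outside the carrier as well.\<close>

lemma basic_op_in_term_ops:
  assumes "(k, f) \<in> F" and "op_on A k f" and "1 \<le> k"
  shows "(k, f) \<in> term_ops A F"
proof -
  let ?gs = "map (proj A k) [0..<k]"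
  have "compose A k f ?gs = f"
  proof
    fix xs
    show "compose A k f ?gs xs = f xs"
    proof (cases "length xs = k \<and> set xs \<subseteq> A")
      case True
      then have "map (\<lambda>g. g xs) ?gs = xs"
        by (auto simp: proj_def intro: nth_equalityI)
      then show ?thesis
        using True by (simp add: compose_def del: map_map)
    next
      case False
      then show ?thesis
        using assms(2) by (auto simp: compose_def op_on_def)
    qed
  qed
  moreover have "(k, compose A k f ?gs) \<in> term_ops A F"
    using assms by (intro comp_in) (auto intro: proj_in)
  ultimately show ?thesis by simp
qed

lemma congruence_subset:
  "congruence A F \<theta> \<Longrightarrow> \<theta> \<subseteq> A \<times> A"
  by (simp add: congruence_def equiv_def)

lemma congruence_refl:
  "congruence A F \<theta> \<Longrightarrow> x \<in> A \<Longrightarrow> (x, x) \<in> \<theta>"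
  by (simp add: congruence_def equiv_def refl_on_def)

lemma congruence_sym:
  "congruence A F \<theta> \<Longrightarrow> (x, y) \<in> \<theta> \<Longrightarrow> (y, x) \<in> \<theta>"
  by (meson congruence_def equiv_def symD)

lemma congruence_trans:
  "congruence A F \<theta> \<Longrightarrow> (x, y) \<in> \<theta> \<Longrightarrow> (y, z) \<in> \<theta> \<Longrightarrow> (x, z) \<in> \<theta>"
  by (meson congruence_def equiv_def transD)


section \<open>The relation \<open>\<Delta>\<close> as a set of functions on the cube\<close>

text \<open>Functions are easier to combine and to reindex than lists. Their values from
  \<open>2 ^ n\<close> on are irrelevant, which is why \<open>cube_rel_cong\<close> is used
  throughout.\<close>

abbreviation cube_rel ::
  "'a set \<Rightarrow> 'a operation set \<Rightarrow> nat \<Rightarrow> (nat \<Rightarrow> ('a \<times> 'a) set) \<Rightarrow> (nat \<Rightarrow> 'a) \<Rightarrow> bool" where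
  "cube_rel A F n \<alpha> g \<equiv> map g [0..<2 ^ n] \<in> Delta A F n \<alpha>"

lemma Delta_length: "v \<in> Delta A F n \<alpha> \<Longrightarrow> length v = 2 ^ n"
  by (induction rule: Delta.induct) (auto simp: ctuple_def)

lemma cube_rel_nth: "v \<in> Delta A F n \<alpha> \<Longrightarrow> cube_rel A F n \<alpha> (nth v)"
  using Delta_length[of v A F n \<alpha>] by (metis map_nth)

lemma cube_rel_cong:
  "cube_rel A F n \<alpha> g \<Longrightarrow> (\<And>k. k < 2 ^ n \<Longrightarrow> h k = g k) \<Longrightarrow> cube_rel A F n \<alpha> h"
  by (erule back_subst[of "\<lambda>v. v \<in> Delta A F n \<alpha>"]) auto

lemma ctuple_eq: "ctuple n i a b = map (\<lambda>k. if bit k i then b else a) [0..<2 ^ n]"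
  by (simp add: ctuple_def bit_iff_odd even_iff_mod_2_eq_zero)

lemma cube_rel_gen:
  "i < n \<Longrightarrow> (a, b) \<in> \<alpha> i \<Longrightarrow> cube_rel A F n \<alpha> (\<lambda>k. if bit k i then b else a)"
  using Delta.gen[of i n a b \<alpha> A F] by (simp add: ctuple_eq)

lemma cube_rel_const:
  assumes "1 \<le> n" and "(a, a) \<in> \<alpha> 0"
  shows "cube_rel A F n \<alpha> (\<lambda>k. a)"
  using cube_rel_gen[of 0 n a a \<alpha> A F] assms by simp

lemma cube_rel_app:
  assumes "(length gs, f) \<in> F" and "\<forall>g \<in> set gs. cube_rel A F n \<alpha> g"
  shows "cube_rel A F n \<alpha> (\<lambda>k. f (map (\<lambda>g. g k) gs))"
proof -
  have "map (\<lambda>j. f (map (\<lambda>v. v ! j) (map (\<lambda>g. map g [0..<2 ^ n]) gs))) [0..<2 ^ n]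
          \<in> Delta A F n \<alpha>"
    using assms by (intro Delta.app) auto
  then show ?thesis
    by (rule back_subst[of "\<lambda>v. v \<in> Delta A F n \<alpha>"]) (auto simp: comp_def)
qed

text \<open>Induction on \<Delta>, transferred from lists to functions. The case \<open>cong\<close>
  is there because many functions represent the same list.\<close>

lemma cube_rel_induct [consumes 1, case_names gen app cong]:
  assumes "cube_rel A F n \<alpha> g"
    and "\<And>i a b. i < n \<Longrightarrow> (a, b) \<in> \<alpha> i \<Longrightarrow> P (\<lambda>k. if bit k i then b else a)"
    and "\<And>f gs. (length gs, f) \<in> F \<Longrightarrow> \<forall>g \<in> set gs. cube_rel A F n \<alpha> g \<and> P g \<Longrightarrow>
           P (\<lambda>k. f (map (\<lambda>g. g k) gs))"
    and cong: "\<And>g h. P g \<Longrightarrow> (\<And>k. k < 2 ^ n \<Longrightarrow> h k = g k) \<Longrightarrow> P h"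
  shows "P g"
proof -
  have "P (nth v)" if "v \<in> Delta A F n \<alpha>" for v
    using that
  proof induction
    case (gen i a b)
    then show ?case
      by (rule cong[OF assms(2)]) (auto simp: ctuple_eq)
  next
    case (app k f vs)
    have "P (\<lambda>j. f (map (\<lambda>g. g j) (map nth vs)))"
      using app by (intro assms(3)) (auto intro: cube_rel_nth)
    then show ?case
      by (rule cong) (auto simp: comp_def)
  qed
  from this[OF assms(1)] show ?thesis
    by (rule cong) auto
qed

lemma cube_rel_in_carrier:
  assumes "algebra A F" and "\<forall>i<n. \<alpha> i \<subseteq> A \<times> A" and "cube_rel A F n \<alpha> g" and "k < 2 ^ n"
  shows "g k \<in> A"
  using assms(3,4)
proof (induction arbitrary: k rule: cube_rel_induct)
  case (app f gs)
  then have "set (map (\<lambda>g. g k) gs) \<subseteq> A"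
    by auto
  with app(1) assms(1) show ?case
    by (auto simp: algebra_def)
qed (use assms(2) in auto)

text \<open>Induction on the term. Values of cube functions lie in the carrier, so
  \<open>proj\<close> and \<open>compose\<close> are never evaluated where they are
  \<open>undefined\<close>.\<close>

lemma cube_rel_term_op:
  assumes "algebra A F" and "\<forall>i<n. \<alpha> i \<subseteq> A \<times> A"
    and "(N, t) \<in> term_ops A F" and "length gs = N" and "\<forall>g \<in> set gs. cube_rel A F n \<alpha> g"
  shows "cube_rel A F n \<alpha> (\<lambda>k. t (map (\<lambda>g. g k) gs))"
proof -
  have carrier: "set (map (\<lambda>g. g k) gs) \<subseteq> A" if "k < 2 ^ n" for k
    using cube_rel_in_carrier[OF assms(1,2)] assms(5) that by auto
  show ?thesis
    using assms(3,4)
  proof induction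
    case (proj_in m i)
    show ?case
      by (rule cube_rel_cong[where g = "gs ! i"])
         (use proj_in assms(5) carrier in \<open>auto simp: proj_def\<close>)
  next
    case (comp_in l f hs m)
    have "cube_rel A F n \<alpha> (\<lambda>k. f (map (\<lambda>g. g k) (map (\<lambda>h k. h (map (\<lambda>g. g k) gs)) hs)))"
      using comp_in by (intro cube_rel_app) auto
    then show ?case
      by (rule cube_rel_cong)
         (use comp_in carrier in \<open>auto simp: compose_def comp_def\<close>)
  qed
qed

text \<open>
  Hypothesis \<open>bits\<close> says that every coordinate of \<open>\<phi>\<close> is a coordinate projection or constant;
  this covers faces of the cube, cylinders over faces, and retractions onto faces.
\<close>

lemma cube_rel_reindex:
  assumes "algebra A F" and "\<forall>i<n. \<alpha> i \<subseteq> A \<times> A"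
    and "1 \<le> m" and "\<forall>x\<in>A. (x, x) \<in> \<beta> 0"
    and less: "\<And>k. k < 2 ^ m \<Longrightarrow> \<phi> k < 2 ^ n"
    and bits: "\<And>i. i < n \<Longrightarrow>
        (\<exists>j<m. \<alpha> i \<subseteq> \<beta> j \<and> (\<forall>k<2 ^ m. bit (\<phi> k) i = bit k j)) \<or>
        (\<exists>c. \<forall>k<2 ^ m. bit (\<phi> k) i = c)"
    and "cube_rel A F n \<alpha> g"
  shows "cube_rel A F m \<beta> (\<lambda>k. g (\<phi> k))"
  using assms(7)
proof (induction rule: cube_rel_induct)
  case (gen i a b)
  from bits[OF gen(1)] show ?case
  proof
    assume "\<exists>j<m. \<alpha> i \<subseteq> \<beta> j \<and> (\<forall>k<2 ^ m. bit (\<phi> k) i = bit k j)"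
    then obtain j where j: "j < m" "\<alpha> i \<subseteq> \<beta> j" "\<forall>k<2 ^ m. bit (\<phi> k) i = bit k j"
      by blast
    then have "cube_rel A F m \<beta> (\<lambda>k. if bit k j then b else a)"
      using gen by (intro cube_rel_gen) auto
    then show ?thesis
      by (rule cube_rel_cong) (use j in auto)
  next
    assume "\<exists>c. \<forall>k<2 ^ m. bit (\<phi> k) i = c"
    then obtain c where c: "\<forall>k<2 ^ m. bit (\<phi> k) i = c"
      by blast
    \<comment> \<open>A generator in a direction where \<open>\<phi>\<close> has a constant bit
      becomes a constant function.\<close>
    have "cube_rel A F m \<beta> (\<lambda>k. if c then b else a)"
      using gen assms(2-4) by (intro cube_rel_const) auto
    then show ?thesis
      by (rule cube_rel_cong) (use c in auto)
  qed
next
  case (app f gs)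
  have "cube_rel A F m \<beta> (\<lambda>k. f (map (\<lambda>g. g k) (map (\<lambda>g k. g (\<phi> k)) gs)))"
    using app by (intro cube_rel_app) auto
  then show ?case
    by (simp add: comp_def)
next
  case (cong g h)
  then show ?case
    using cube_rel_cong less by metis
qed

text \<open>
  The quantification over all lists \<open>G\<close> above the finite set \<open>S\<close> lets the representations of the
  arguments of an operation be brought to a common list of generators.
\<close>

lemma cube_rel_term_representation:
  assumes "cube_rel A F n \<alpha> g" and sub: "\<forall>i<n. \<alpha> i \<subseteq> A \<times> A"
  shows "\<exists>S. finite S \<and> S \<subseteq> Sigma {..<n} \<alpha> \<and>
    (\<forall>G. G \<noteq> [] \<and> S \<subseteq> set G \<and> set G \<subseteq> Sigma {..<n} \<alpha> \<longrightarrow>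
      (\<exists>t. (length G, t) \<in> term_ops A F \<and>
           (\<forall>k<2 ^ n. g k = t (map (\<lambda>(i, a, b). if bit k i then b else a) G))))"
    (is "\<exists>S. ?rep g S")
  using assms(1)
proof (induction rule: cube_rel_induct)
  case (gen i a b)
  have "?rep (\<lambda>k. if bit k i then b else a) {(i, a, b)}"
  proof (intro conjI allI impI; (elim conjE)?)
    fix G assume G: "{(i, a, b)} \<subseteq> set G" "set G \<subseteq> Sigma {..<n} \<alpha>"
    then obtain l where l: "l < length G" "G ! l = (i, a, b)"
      by (auto simp: in_set_conv_nth)
    have "set (map (\<lambda>(i, a, b). if bit k i then b else a) G) \<subseteq> A" for k :: nat
      using G sub by fastforce
    then have "(if bit k i then b else a)
        = proj A (length G) l (map (\<lambda>(i, a, b). if bit k i then b else a) G)" for k :: nat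
      using l by (simp add: proj_def)
    moreover have "(length G, proj A (length G) l) \<in> term_ops A F"
      using l(1) by (intro proj_in) auto
    ultimately show "\<exists>t. (length G, t) \<in> term_ops A F \<and>
        (\<forall>k<(2::nat) ^ n. (if bit k i then b else a) = t (map (\<lambda>(i, a, b). if bit k i then b else a) G))"
      by blast
  qed (use gen in auto)
  then show ?case ..
next
  case (app f gs)
  then obtain S where S: "\<forall>g \<in> set gs. ?rep g (S g)"
    by metis
  have "?rep (\<lambda>k. f (map (\<lambda>g. g k) gs)) (\<Union>g \<in> set gs. S g)"
  proof (intro conjI allI impI; (elim conjE)?)
    fix G assume G: "G \<noteq> []" "(\<Union>g \<in> set gs. S g) \<subseteq> set G" "set G \<subseteq> Sigma {..<n} \<alpha>"
    let ?G = "\<lambda>k::nat. map (\<lambda>(i, a, b). if bit k i then b else a) G"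
    have "\<exists>t. (length G, t) \<in> term_ops A F \<and> (\<forall>k<2 ^ n. g k = t (?G k))"
      if "g \<in> set gs" for g
    proof -
      have "S g \<subseteq> set G"
        using G(2) that by blast
      with bspec[OF S that] G(1,3) show ?thesis
        by (elim conjE allE[of _ G]) simp
    qed
    then have "\<forall>g \<in> set gs. \<exists>t. (length G, t) \<in> term_ops A F \<and> (\<forall>k<2 ^ n. g k = t (?G k))"
      by simp
    from bchoice[OF this] obtain t where t: "\<forall>g \<in> set gs. (length G, t g) \<in> term_ops A F"
        "\<forall>g \<in> set gs. \<forall>k<2 ^ n. g k = t g (?G k)"
      by auto
    have in_A: "set (?G k) \<subseteq> A" for k
    proof -
      have "(if bit k i then b else a) \<in> A" if "(i, a, b) \<in> set G" for i a b
        using G(3) sub that by auto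
      then show ?thesis
        by auto
    qed
    show "\<exists>t. (length G, t) \<in> term_ops A F \<and>
        (\<forall>k<2 ^ n. f (map (\<lambda>g. g k) gs) = t (?G k))"
    proof (intro exI conjI allI impI)
      show "(length G, compose A (length G) f (map t gs)) \<in> term_ops A F"
        using app(1) G(1) t(1) by (intro comp_in) (auto simp: Suc_le_eq)
      fix k :: nat assume "k < 2 ^ n"
      then have "map (\<lambda>g. g k) gs = map (\<lambda>g. t g (?G k)) gs"
        using t(2) by auto
      moreover have "compose A (length G) f (map t gs) (?G k) = f (map (\<lambda>g. t g (?G k)) gs)"
        using in_A[of k] by (simp add: compose_def comp_def)
      ultimately show "f (map (\<lambda>g. g k) gs) = compose A (length G) f (map t gs) (?G k)"
        by (simp only:)
    qed
  qed (use S in auto)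
  then show ?case ..
next
  case (cong g h)
  then show ?case by simp
qed


section \<open>Commutators as forks\<close>

definition fork :: "nat set \<Rightarrow> 'a \<Rightarrow> 'a \<Rightarrow> nat \<Rightarrow> 'a" where
  "fork I x y k = (if \<forall>i\<in>I. bit k i then y else x)"

text \<open>The arguments of the term in \<open>centralizes\<close> at the corner \<open>s\<close>.
  With \<open>s = bit k\<close>, corners become vertices of the cube.\<close>

definition choice :: "(nat \<Rightarrow> 'a list) \<Rightarrow> (nat \<Rightarrow> 'a list) \<Rightarrow> (nat \<Rightarrow> bool) \<Rightarrow> nat \<Rightarrow> 'a list" where
  "choice a b s m = concat (map (\<lambda>i. if s i then b i else a i) [0..<m])"

lemma choice_cong:
  "(\<And>i. i < m \<Longrightarrow> s i = s' i) \<Longrightarrow> choice a b s m = choice a b s' m"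
  unfolding choice_def by (intro arg_cong[where f = concat] map_cong) auto

lemma choice_Suc: "choice a b s (Suc r) = choice a b s r @ (if s r then b r else a r)"
  by (simp add: choice_def)

lemma choice_True: "choice a b (\<lambda>_. True) m = concat (map b [0..<m])"
  by (simp add: choice_def)

text \<open>Replacing \<open>m\<close> by \<open>Suc r\<close> removes the truncated subtraction and
  exposes the last block of arguments as direction \<open>r\<close> of the cube.\<close>

lemma centralizes_Suc:
  "centralizes A F (Suc r) \<alpha> \<gamma> \<longleftrightarrow>
     (\<forall>N t a b. (N, t) \<in> term_ops A F \<longrightarrow>
        (\<forall>i < Suc r. length (a i) = length (b i) \<and> a i \<noteq> b i \<and>
                  list_all2 (\<lambda>x y. (x, y) \<in> \<alpha> i) (a i) (b i)) \<longrightarrow>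
        (\<Sum>i<Suc r. length (a i)) = N \<longrightarrow>
        (\<forall>s. (\<exists>i<r. \<not> s i) \<longrightarrow>
           (t (choice a b s r @ a r), t (choice a b s r @ b r)) \<in> \<gamma>) \<longrightarrow>
        (t (choice a b (\<lambda>_. True) r @ a r), t (choice a b (\<lambda>_. True) r @ b r)) \<in> \<gamma>)"
  unfolding centralizes_def choice_True by (simp add: choice_def)

text \<open>Setting all bits outside \<open>I\<close> sends a vertex to one that contains
  \<open>J\<close> exactly when the original contains \<open>I\<close>. For nonempty
  \<open>I\<close> this is the monotonicity of commutators: the one of \<open>J\<close> lies in the
  one of \<open>I\<close>.\<close>

lemma fork_subset:
  assumes "algebra A F" and "\<forall>i<n. congruence A F (\<alpha> i)" and "1 \<le> n"
    and "I \<subseteq> J" and "J \<subseteq> {..<n}" and "cube_rel A F n \<alpha> (fork J x y)"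
  shows "cube_rel A F n \<alpha> (fork I x y)"
proof -
  let ?\<phi> = "\<lambda>k. of_bits n (\<lambda>i. i \<in> I \<longrightarrow> bit k i)"
  have "cube_rel A F n \<alpha> (\<lambda>k. fork J x y (?\<phi> k))"
  proof (rule cube_rel_reindex[OF assms(1) _ assms(3) _ _ _ assms(6)])
    show "\<forall>i<n. \<alpha> i \<subseteq> A \<times> A" "\<forall>x\<in>A. (x, x) \<in> \<alpha> 0"
      using assms(2,3) by (auto dest: congruence_subset congruence_refl simp: Suc_le_eq)
    show "(\<exists>j<n. \<alpha> i \<subseteq> \<alpha> j \<and> (\<forall>k<2 ^ n. bit (?\<phi> k) i = bit k j)) \<or>
        (\<exists>c. \<forall>k<2 ^ n. bit (?\<phi> k) i = c)" if "i < n" for i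
      using that by (cases "i \<in> I") auto
  qed simp
  moreover have "fork J x y (?\<phi> k) = fork I x y k" for k
    using assms(4,5) by (auto simp: fork_def)
  ultimately show ?thesis
    by simp
qed

section \<open>Mal'cev algebras with a finite family of congruences\<close>

locale malcev_algebra =
  fixes A :: "'a set" and F :: "'a operation set" and q :: "'a list \<Rightarrow> 'a"
  assumes algebra: "algebra A F"
    and q_term: "(3, q) \<in> term_ops A F"
    and malcev: "\<forall>x \<in> A. \<forall>y \<in> A. q [x, x, y] = y \<and> q [y, x, x] = y"
begin

lemma q_eq_left [simp]: "x \<in> A \<Longrightarrow> y \<in> A \<Longrightarrow> q [x, x, y] = y"
  and q_eq_right [simp]: "x \<in> A \<Longrightarrow> y \<in> A \<Longrightarrow> q [y, x, x] = y"
  using malcev by auto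

lemma q_cube_rel:
  assumes "\<forall>i<n. \<alpha> i \<subseteq> A \<times> A"
    and "cube_rel A F n \<alpha> u" and "cube_rel A F n \<alpha> v" and "cube_rel A F n \<alpha> w"
  shows "cube_rel A F n \<alpha> (\<lambda>k. q [u k, v k, w k])"
  using cube_rel_term_op[OF algebra assms(1) q_term, of "[u, v, w]"] assms(2-4) by simp

end

text \<open>The operations, the dimension and the family are all parameters, because the locale is
  also interpreted for faces of the cube and for clones in place of \<open>F\<close>.\<close>

locale malcev_congruences = malcev_algebra +
  fixes n :: nat and \<alpha> :: "nat \<Rightarrow> ('a \<times> 'a) set"
  assumes n_pos: "1 \<le> n"
    and congruences: "\<forall>i<n. congruence A F (\<alpha> i)"
begin

lemma \<alpha>_subset: "\<forall>i<n. \<alpha> i \<subseteq> A \<times> A"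
  using congruences congruence_subset by blast

lemma \<alpha>_refl: "\<forall>x\<in>A. (x, x) \<in> \<alpha> 0"
proof -
  have "congruence A F (\<alpha> 0)"
    using congruences n_pos by simp
  then show ?thesis
    using congruence_refl by metis
qed

lemma const: "x \<in> A \<Longrightarrow> cube_rel A F n \<alpha> (\<lambda>k. x)"
  using cube_rel_const[OF n_pos, where \<alpha> = \<alpha>] \<alpha>_refl by simp

lemmas in_carrier = cube_rel_in_carrier[OF algebra \<alpha>_subset]
lemmas q_closed = q_cube_rel[OF \<alpha>_subset]
lemmas reindex = cube_rel_reindex[OF algebra \<alpha>_subset]
lemmas fork_mono = fork_subset[OF algebra congruences n_pos]

section \<open>The congruence given by the forks at the top vertex\<close>

definition top_forks :: "('a \<times> 'a) set" where
  "top_forks = {(x, y). cube_rel A F n \<alpha> (fork {..<n} x y)}"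

lemma fork_top: "k < 2 ^ n \<Longrightarrow> fork {..<n} x y k = (if k = 2 ^ n - 1 then y else x)"
  using all_bits_iff[of k n] by (auto simp: fork_def)

lemma top_forks_subset: "top_forks \<subseteq> A \<times> A"
proof (clarify)
  fix x y assume "(x, y) \<in> top_forks"
  then have *: "cube_rel A F n \<alpha> (fork {..<n} x y)"
    by (simp add: top_forks_def)
  \<comment> \<open>The vertex \<open>0\<close> differs from the top vertex, so both values of the
    fork occur.\<close>
  have "(1::nat) < 2 ^ n"
    using n_pos one_less_power[of "2::nat" n] by simp
  then show "x \<in> A \<and> y \<in> A"
    using in_carrier[OF *, of 0] in_carrier[OF *, of "2 ^ n - 1"] by (simp add: fork_top)
qed

lemma top_forks_app:
  assumes "(k, f) \<in> F"
  shows "preserves k f top_forks"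
  unfolding preserves_def
proof (intro allI impI, elim conjE)
  fix xs ys
  assume *: "length xs = k" "length ys = k" "list_all2 (\<lambda>x y. (x, y) \<in> top_forks) xs ys"
  let ?gs = "map2 (fork {..<n}) xs ys"
  have "cube_rel A F n \<alpha> (\<lambda>k. f (map (\<lambda>g. g k) ?gs))"
  proof (rule cube_rel_app)
    show "\<forall>g \<in> set ?gs. cube_rel A F n \<alpha> g"
      using * by (auto simp: list_all2_iff top_forks_def)
  qed (use * assms in simp)
  moreover have "f (map (\<lambda>g. g k) ?gs) = fork {..<n} (f xs) (f ys) k" for k
  proof (cases "\<forall>i<n. bit k i")
    case True
    then have "map (\<lambda>g. g k) ?gs = ys"
      using * by (intro nth_equalityI) (auto simp: fork_def)
    then show ?thesis
      using True by (simp add: fork_def del: map_map)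
  next
    case False
    then have "map (\<lambda>g. g k) ?gs = xs"
      using * by (intro nth_equalityI) (auto simp: fork_def)
    then show ?thesis
      using False by (auto simp: fork_def simp del: map_map)
  qed
  ultimately show "(f xs, f ys) \<in> top_forks"
    by (simp add: top_forks_def)
qed

text \<open>Operations act on forks value by value. As \<open>q\<close> is only a term operation and
  need not belong to \<open>F\<close>, \<open>top_forks_app\<close> does not cover it.\<close>

lemma top_forks_q:
  assumes "(x, x') \<in> top_forks" and "(y, y') \<in> top_forks" and "(z, z') \<in> top_forks"
  shows "(q [x, y, z], q [x', y', z']) \<in> top_forks"
proof -
  have "cube_rel A F n \<alpha> (\<lambda>k. q [fork {..<n} x x' k, fork {..<n} y y' k, fork {..<n} z z' k])"
    using assms by (intro q_closed) (auto simp: top_forks_def)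
  moreover have "q [fork {..<n} x x' k, fork {..<n} y y' k, fork {..<n} z z' k]
      = fork {..<n} (q [x, y, z]) (q [x', y', z']) k" for k
    by (auto simp: fork_def)
  ultimately show ?thesis
    by (simp add: top_forks_def)
qed

lemma top_forks_refl: "x \<in> A \<Longrightarrow> (x, x) \<in> top_forks"
  using const by (simp add: top_forks_def fork_def[abs_def])

text \<open>For a Mal'cev term, every compatible reflexive relation is a congruence.\<close>

lemma congruence_top_forks: "congruence A F top_forks"
proof -
  have "sym top_forks"
  proof (rule symI)
    fix x y assume "(x, y) \<in> top_forks"
    moreover from this have "x \<in> A" "y \<in> A"
      using top_forks_subset by auto
    \<comment> \<open>Apply \<open>q\<close> to the pairs \<open>(x, x)\<close>,
      \<open>(x, y)\<close>, \<open>(y, y)\<close>.\<close>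
    ultimately show "(y, x) \<in> top_forks"
      using top_forks_q[of x x x y y y] top_forks_refl by simp
  qed
  moreover have "trans top_forks"
  proof (rule transI)
    fix x y z assume "(x, y) \<in> top_forks" "(y, z) \<in> top_forks"
    moreover from this have "x \<in> A" "y \<in> A" "z \<in> A"
      using top_forks_subset by auto
    \<comment> \<open>Apply \<open>q\<close> to the pairs \<open>(x, y)\<close>,
      \<open>(y, y)\<close>, \<open>(y, z)\<close>.\<close>
    ultimately show "(x, z) \<in> top_forks"
      using top_forks_q[of x y y y y z] top_forks_refl by simp
  qed
  ultimately show ?thesis
    using top_forks_subset top_forks_refl top_forks_app
    by (auto simp: congruence_def equiv_def refl_on_def)
qed

section \<open>Terms on cubes and the two bounds for the commutator\<close>

text \<open>Each argument in block \<open>i\<close> runs through a generator in direction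
  \<open>i\<close>. Hence the values of \<open>t\<close> at the corners of a centrality
  configuration form an element of \<Delta>.\<close>

lemma cube_rel_choice:
  assumes "(N, t) \<in> term_ops A F" and "(\<Sum>i<n. length (a i)) = N"
    and "\<forall>i<n. list_all2 (\<lambda>x y. (x, y) \<in> \<alpha> i) (a i) (b i)"
  shows "cube_rel A F n \<alpha> (\<lambda>k. t (choice a b (bit k) n))"
proof -
  let ?gs = "concat (map (\<lambda>i. map2 (\<lambda>x y (k::nat). if bit k i then y else x) (a i) (b i)) [0..<n])"
  have len: "length (a i) = length (b i)" if "i < n" for i
    using assms(3) that list_all2_lengthD by blast
  have map2_fst: "map2 (\<lambda>x y. x) xs ys = xs" and map2_snd: "map2 (\<lambda>x y. y) xs ys = ys"
    if "length xs = length ys" for xs ys :: "'a list"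
    using that by (auto intro: nth_equalityI)
  have "cube_rel A F n \<alpha> (\<lambda>k. t (map (\<lambda>g. g k) ?gs))"
  proof (rule cube_rel_term_op[OF algebra \<alpha>_subset assms(1)])
    have "length ?gs = (\<Sum>i<n. min (length (a i)) (length (b i)))"
      by (simp add: length_concat comp_def interv_sum_list_conv_sum_set_nat atLeast0LessThan)
    also have "\<dots> = (\<Sum>i<n. length (a i))"
      by (intro sum.cong) (auto simp: len)
    finally have "length ?gs = (\<Sum>i<n. length (a i))" .
    then show "length ?gs = N"
      using assms(2) by simp
    show "\<forall>g\<in>set ?gs. cube_rel A F n \<alpha> g"
      using assms(3) by (auto simp: list_all2_iff intro!: cube_rel_gen)
  qed
  moreover have "map (\<lambda>g. g k) ?gs = choice a b (bit k) n" for k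
    unfolding choice_def map_concat map_map
    by (intro arg_cong[where f = concat] map_cong)
       (auto simp: comp_def case_prod_unfold len map2_fst[unfolded case_prod_unfold]
         map2_snd[unfolded case_prod_unfold])
  ultimately show ?thesis
    by (simp only:)
qed

text \<open>A fork is a term operation applied to generators. Once these are sorted by direction,
  the term has value \<open>x\<close> at all corners but the top one, where it has value
  \<open>y\<close>, and centrality puts \<open>(x, y)\<close> into \<open>\<theta>\<close>.\<close>

lemma top_forks_least:
  assumes \<theta>: "congruence A F \<theta>" and "centralizes A F n \<alpha> \<theta>"
  shows "top_forks \<subseteq> \<theta>"
proof (clarify)
  fix x y assume xy: "(x, y) \<in> top_forks"
  then obtain S where S: "finite S" "S \<subseteq> Sigma {..<n} \<alpha>"
    and rep: "\<And>G. G \<noteq> [] \<Longrightarrow> S \<subseteq> set G \<Longrightarrow> set G \<subseteq> Sigma {..<n} \<alpha> \<Longrightarrow>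
      \<exists>t. (length G, t) \<in> term_ops A F \<and>
        (\<forall>k<2 ^ n. fork {..<n} x y k = t (map (\<lambda>(i, a, b). if bit k i then b else a) G))"
    unfolding top_forks_def
    using cube_rel_term_representation[OF _ \<alpha>_subset, where F = F and g = "fork {..<n} x y"] by auto
  have "x \<in> A"
    using xy top_forks_subset by auto
  \<comment> \<open>Block \<open>i\<close> collects the generators of \<open>S\<close> in direction
    \<open>i\<close>. The extra pair \<open>(x, x)\<close> keeps the list of all generators
    nonempty, as terms have positive arity.\<close>
  have "\<forall>i. \<exists>ps. set ps = insert (x, x) {p. (i, p) \<in> S}"
  proof
    fix i
    have "finite {p. (i, p) \<in> S}"
      by (rule finite_subset[OF _ finite_imageI[OF S(1), of snd]]) force
    then show "\<exists>ps. set ps = insert (x, x) {p. (i, p) \<in> S}"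
      by (intro finite_list) simp
  qed
  then obtain L where L: "\<And>i. set (L i) = insert (x, x) {p. (i, p) \<in> S}"
    by metis
  define a b where "a i = map fst (L i)" and "b i = map snd (L i)" for i
  let ?G = "concat (map (\<lambda>i. map (Pair i) (L i)) [0..<n])"
  have \<alpha>_L: "(u, v) \<in> \<alpha> i" if "i < n" "(u, v) \<in> set (L i)" for u v i
  proof -
    have "(x, x) \<in> \<alpha> i"
      using congruences \<open>i < n\<close> \<open>x \<in> A\<close> congruence_refl by metis
    then show ?thesis
      using that S(2) by (auto simp: L)
  qed
  have "set ?G \<subseteq> Sigma {..<n} \<alpha>"
    using \<alpha>_L by auto
  moreover have "S \<subseteq> set ?G"
    using S(2) by (force simp: L)
  moreover have "?G \<noteq> []"
    using n_pos L[of 0] by (force simp: Suc_le_eq)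
  ultimately obtain t where t: "(length ?G, t) \<in> term_ops A F"
    and val: "\<forall>k<2 ^ n. fork {..<n} x y k = t (map (\<lambda>(i, a, b). if bit k i then b else a) ?G)"
    using rep[of ?G] by blast
  have val: "t (choice a b s n) = (if \<forall>i<n. s i then y else x)" for s
  proof -
    let ?k = "of_bits n s"
    have "map (\<lambda>(i, a, b). if bit ?k i then b else a) ?G = choice a b (bit ?k) n"
      unfolding choice_def map_concat map_map
      by (intro arg_cong[where f = concat] map_cong) (auto simp: a_def b_def)
    also have "\<dots> = choice a b s n"
      by (rule choice_cong) simp
    finally show ?thesis
      using val[rule_format, of ?k] by (auto simp: fork_def split: if_splits)
  qed
  show "(x, y) \<in> \<theta>"
  proof (cases "\<exists>i<n. a i = b i")
    \<comment> \<open>Centrality speaks only of blocks with \<open>a i \<noteq> b i\<close>. If the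
      two agree, flipping bit \<open>i\<close> of the top corner does not change the arguments, and
      the fork is trivial.\<close>
    case True
    then obtain i where i: "i < n" "a i = b i" by blast
    have "choice a b (\<lambda>_. True) n = choice a b (\<lambda>j. j \<noteq> i) n"
      unfolding choice_def
      by (intro arg_cong[where f = concat] map_cong) (auto simp: i)
    then have "y = x"
      using val[of "\<lambda>_. True"] val[of "\<lambda>j. j \<noteq> i"] i(1) by (auto split: if_splits)
    then show ?thesis
      using congruence_refl[OF \<theta> \<open>x \<in> A\<close>] by simp
  next
    case False
    obtain r where r: "n = Suc r"
      using n_pos by (cases n) auto
    \<comment> \<open>Only the entries of \<open>s\<close> below \<open>r\<close> matter here, so
      \<open>s r\<close> can be chosen to select the desired last block.\<close>
    have val_a: "t (choice a b s r @ a r) = x" for s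
    proof -
      have "choice a b s r = choice a b (s(r := False)) r"
        by (rule choice_cong) auto
      then show ?thesis
        using val[of "s(r := False)"] by (auto simp: r choice_Suc)
    qed
    have val_b: "t (choice a b s r @ b r) = (if \<forall>i<r. s i then y else x)" for s
    proof -
      have "choice a b s r = choice a b (s(r := True)) r"
        by (rule choice_cong) auto
      then show ?thesis
        using val[of "s(r := True)"] by (auto simp: r choice_Suc less_Suc_eq)
    qed
    have len: "(\<Sum>i<Suc r. length (a i)) = length ?G"
      by (simp only: r length_concat map_map)
         (simp add: comp_def a_def interv_sum_list_conv_sum_set_nat atLeast0LessThan)
    have "(t (choice a b (\<lambda>_. True) r @ a r), t (choice a b (\<lambda>_. True) r @ b r)) \<in> \<theta>"
    proof (rule assms(2)[unfolded r centralizes_Suc, rule_format, OF t _ len])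
      fix i assume "i < Suc r"
      then show "length (a i) = length (b i) \<and> a i \<noteq> b i \<and>
          list_all2 (\<lambda>x y. (x, y) \<in> \<alpha> i) (a i) (b i)"
        using False \<alpha>_L[of i] r
        by (auto simp: a_def b_def list_all2_conv_all_nth) (metis nth_mem prod.collapse)
    next
      fix s assume "\<exists>i<r. \<not> s i"
      then show "(t (choice a b s r @ a r), t (choice a b s r @ b r)) \<in> \<theta>"
        using congruence_refl[OF \<theta> \<open>x \<in> A\<close>] by (auto simp: val_a val_b)
    qed
    then show ?thesis
      by (simp add: val_a val_b)
  qed
qed

text \<open>
  The key step of centrality: if the edges of \<open>v\<close> in the last direction, except possibly the top
  one, lie in \<^term>\<open>top_forks\<close>, then \<open>v\<close> can be corrected on its upper half, one vertex after the
  other, until the two ends of each of these edges agree.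
\<close>

lemma equalize_edges:
  assumes r: "n = Suc r" and v: "cube_rel A F n \<alpha> v"
    and edges: "\<forall>k<2 ^ r - 1. (v k, v (2 ^ r + k)) \<in> top_forks"
    and "j \<le> 2 ^ r - 1"
  shows "\<exists>w. cube_rel A F n \<alpha> w \<and> (\<forall>k<2 ^ r. w k = v k) \<and>
    (\<forall>k<j. w (2 ^ r + k) = v k) \<and> (\<forall>k<2 ^ n. (w k, v k) \<in> top_forks)"
  using assms(4)
proof (induction j)
  case 0
  then show ?case
    using v top_forks_refl in_carrier[OF v] by (intro exI[of _ v]) simp
next
  case (Suc j)
  then obtain w where w: "cube_rel A F n \<alpha> w" "\<forall>k<2 ^ r. w k = v k"
    "\<forall>k<j. w (2 ^ r + k) = v k" "\<forall>k<2 ^ n. (w k, v k) \<in> top_forks"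
    by auto
  have j: "j < 2 ^ r" "j < 2 ^ r - 1" "2 ^ r + j < 2 ^ n"
    using Suc.prems by (auto simp: r)
  define p where "p = 2 ^ r + j"
  define x y where "x = w p" and "y = v j"
  have in_A: "x \<in> A" "y \<in> A"
    using in_carrier[OF w(1), of p] in_carrier[OF v, of j] j by (auto simp: x_def y_def p_def)
  define I where "I = {i. bit p i}"
  have I: "I \<subseteq> {..<n}"
    using bit_imp_less_exponent[of p n] j(3) by (auto simp: I_def p_def)
  have fork_below: "fork I x y k = x" if "k < p" for k
    using bit_subset_imp_le[of p k] that by (auto simp: fork_def I_def)
  have fork_at: "fork I x y p = y"
    by (simp add: fork_def I_def)
  note cong = congruence_sym[OF congruence_top_forks] congruence_trans[OF congruence_top_forks]
  \<comment> \<open>The current value \<open>x\<close> at \<open>p\<close> and the desired value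
    \<open>y\<close> are related through \<open>v p\<close>. The top fork of this pair then
    restricts to a fork on the smaller set \<open>I\<close>.\<close>
  have "(v p, v j) \<in> top_forks"
    using edges j(2) cong(1) by (simp add: p_def)
  then have xy: "(x, y) \<in> top_forks"
    using cong(2) w(4) j(3) by (auto simp: x_def y_def p_def)
  then have "cube_rel A F n \<alpha> (fork I x y)"
    using fork_mono[OF I] by (auto simp: top_forks_def)
  \<comment> \<open>Where the fork equals \<open>x\<close>, in particular below \<open>p\<close>,
    \<open>w'\<close> coincides with \<open>w\<close>. At \<open>p\<close> it is
    \<open>q [x, x, y] = y\<close>.\<close>
  define w' where "w' k = q [w k, x, fork I x y k]" for k
  have "cube_rel A F n \<alpha> w'"
    unfolding w'_def using w(1) const[OF in_A(1)] \<open>cube_rel A F n \<alpha> (fork I x y)\<close>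
    by (rule q_closed)
  moreover have below: "w' k = w k" if "k < p" for k
    using that fork_below in_A in_carrier[OF w(1), of k] j by (simp add: w'_def p_def)
  moreover have "w' p = y"
    using fork_at in_A by (simp add: w'_def x_def)
  \<comment> \<open>Above \<open>p\<close> the correction may alter \<open>w\<close>, but only
    within \<open>top_forks\<close>, as the fork is everywhere related to \<open>x\<close>.\<close>
  moreover have "(w' k, v k) \<in> top_forks" if k: "k < 2 ^ n" for k
  proof -
    have "w k \<in> A"
      using in_carrier[OF w(1) k] .
    have "(fork I x y k, x) \<in> top_forks"
      using xy cong(1) top_forks_refl[OF in_A(1)] by (simp add: fork_def)
    then have "(q [w k, x, fork I x y k], q [w k, x, x]) \<in> top_forks"
      using \<open>w k \<in> A\<close> in_A by (intro top_forks_q top_forks_refl) auto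
    then have "(w' k, w k) \<in> top_forks"
      using \<open>w k \<in> A\<close> in_A by (simp add: w'_def)
    then show ?thesis
      using w(4) k cong(2) by blast
  qed
  ultimately show ?case
    using w(2,3) by (intro exI[of _ w']) (auto simp: less_Suc_eq p_def y_def)
qed

text \<open>Equalize all edges but the top one, and compare the result \<open>w\<close> with its own
  lower half by \<open>q\<close>. The differences cancel at every vertex but the top one, so a fork
  remains. Its value at the top is related to that of \<open>v\<close>.\<close>

lemma top_edge_in_top_forks:
  assumes r: "n = Suc r" and v: "cube_rel A F n \<alpha> v"
    and edges: "\<forall>k<2 ^ r - 1. (v k, v (2 ^ r + k)) \<in> top_forks"
  shows "(v (2 ^ r - 1), v (2 ^ n - 1)) \<in> top_forks"
proof -
  obtain w where w: "cube_rel A F n \<alpha> w" "\<forall>k<2 ^ r. w k = v k"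
    "\<forall>k<2 ^ r - 1. w (2 ^ r + k) = v k" "\<forall>k<2 ^ n. (w k, v k) \<in> top_forks"
    using equalize_edges[OF assms order.refl] by blast
  define x y where "x = v (2 ^ r - 1)" and "y = w (2 ^ n - 1)"
  \<comment> \<open>Clearing bit \<open>r\<close> copies the lower half of \<open>w\<close> onto the
    upper half.\<close>
  have half: "cube_rel A F n \<alpha> (\<lambda>k. w (take_bit r k))"
  proof (rule reindex[where \<beta> = \<alpha> and g = w, OF n_pos \<alpha>_refl _ _ w(1)])
    fix k :: nat
    have "take_bit r k < 2 ^ r" by simp
    then show "take_bit r k < 2 ^ n" by (simp add: r del: take_bit_nat_less_exp)
  next
    fix i assume "i < n"
    then show "(\<exists>j<n. \<alpha> i \<subseteq> \<alpha> j \<and> (\<forall>k<2 ^ n. bit (take_bit r k) i = bit k j)) \<or>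
        (\<exists>c. \<forall>k<2 ^ n. bit (take_bit r k) i = c)"
      by (cases "i < r") (auto simp: bit_take_bit_iff)
  qed
  have in_A: "x \<in> A" "y \<in> A"
    using in_carrier[OF v, of "2 ^ r - 1"] in_carrier[OF w(1), of "2 ^ n - 1"]
    by (auto simp: x_def y_def r less_imp_diff_less)
  have "q [w k, w (take_bit r k), x] = fork {..<n} x y k" if k: "k < 2 ^ n" for k
  proof -
    have "w k \<in> A"
      using in_carrier[OF w(1) k] .
    consider "k < 2 ^ r" | l where "k = 2 ^ r + l" "l < 2 ^ r - 1" | "k = 2 ^ n - 1"
    proof -
      have "l < 2 ^ r - 1 \<or> k = 2 ^ n - 1" if "k = 2 ^ r + l" for l
        using that k by (auto simp: r)
      then show thesis
        using that le_Suc_ex[of "2 ^ r" k] by (metis not_le)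
    qed
    then show ?thesis
    proof cases
      case 1
      then have "k \<noteq> 2 ^ n - 1"
        by (auto simp: r)
      then show ?thesis
        using 1 \<open>w k \<in> A\<close> in_A by (simp add: take_bit_nat_eq_self fork_top[OF k])
    next
      case 2
      then have "take_bit r k = l"
        by (simp add: take_bit_eq_mod)
      moreover have "k \<noteq> 2 ^ n - 1"
        using 2 by (auto simp: r)
      then have "fork {..<n} x y k = x"
        by (simp add: fork_top[OF k])
      ultimately show ?thesis
        using 2 w(2,3) \<open>w k \<in> A\<close> in_A by simp
    next
      case 3
      then have "k = 2 ^ r + (2 ^ r - 1)"
        by (simp add: r)
      moreover have "take_bit r (2 ^ r + l) = l" if "l < 2 ^ r" for l :: nat
        using that by (simp add: take_bit_eq_mod)
      from this[of "2 ^ r - 1"] have "take_bit r (2 ^ r + (2 ^ r - 1)) = (2 ^ r - 1 :: nat)"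
        by simp
      ultimately have "take_bit r k = 2 ^ r - 1"
        by (simp only:)
      then have "w (take_bit r k) = x"
        using w(2) by (simp add: x_def)
      moreover have "w k = y" "fork {..<n} x y k = y"
        using 3 fork_top[OF k] by (simp_all add: y_def)
      ultimately show ?thesis
        using in_A by simp
    qed
  qed
  then have "cube_rel A F n \<alpha> (fork {..<n} x y)"
    using cube_rel_cong[OF q_closed[OF w(1) half const[OF in_A(1)]]] by metis
  then have "(x, y) \<in> top_forks"
    by (simp add: top_forks_def)
  moreover have "(y, v (2 ^ n - 1)) \<in> top_forks"
    using w(4) by (simp add: y_def)
  ultimately show ?thesis
    using congruence_trans[OF congruence_top_forks] by (auto simp: x_def)
qed

text \<open>The corners with last block \<open>a r\<close> form the lower half of a cube in
  \<Delta>, those with \<open>b r\<close> the upper half. The premises of centrality concern all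
  edges in direction \<open>r\<close> but the top one, and the conclusion concerns that one.\<close>

lemma centralizes_top_forks: "centralizes A F n \<alpha> top_forks"
proof -
  obtain r where r: "n = Suc r"
    using n_pos by (cases n) auto
  have "centralizes A F (Suc r) \<alpha> top_forks"
    unfolding centralizes_Suc
  proof (intro allI impI)
    fix N t a b
    assume t: "(N, t) \<in> term_ops A F"
      and ab: "\<forall>i<Suc r. length (a i) = length (b i) \<and> a i \<noteq> b i \<and>
                  list_all2 (\<lambda>x y. (x, y) \<in> \<alpha> i) (a i) (b i)"
      and len: "(\<Sum>i<Suc r. length (a i)) = N"
      and edges: "\<forall>s. (\<exists>i<r. \<not> s i) \<longrightarrow>
           (t (choice a b s r @ a r), t (choice a b s r @ b r)) \<in> top_forks"
    define v where "v k = t (choice a b (bit k) n)" for k :: nat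
    have v: "cube_rel A F n \<alpha> v"
      unfolding v_def using cube_rel_choice[OF t] len ab by (simp add: r)
    have lower: "v k = t (choice a b (bit k) r @ a r)" if "k < 2 ^ r" for k
      using bit_imp_less_exponent[OF that, of r] by (auto simp: v_def r choice_Suc)
    have upper: "v (2 ^ r + k) = t (choice a b (bit k) r @ b r)" if "k < 2 ^ r" for k
    proof -
      have "choice a b (bit (2 ^ r + k)) r = choice a b (bit k) r"
        by (rule choice_cong) (simp add: bit_add_exponent[OF that])
      then show ?thesis
        by (simp add: v_def r choice_Suc bit_add_exponent[OF that])
    qed
    have "(v k, v (2 ^ r + k)) \<in> top_forks" if "k < 2 ^ r - 1" for k
    proof -
      have "k < 2 ^ r" using that by simp
      moreover from this have "\<exists>i<r. \<not> bit k i"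
        using that all_bits_iff[of k r] by auto
      ultimately show ?thesis
        using edges by (simp add: lower upper)
    qed
    then have "(v (2 ^ r - 1), v (2 ^ n - 1)) \<in> top_forks"
      by (intro top_edge_in_top_forks[OF r v]) simp
    moreover have "2 ^ n - 1 = 2 ^ r + (2 ^ r - 1 :: nat)"
      by (simp add: r)
    moreover have "choice a b (bit (2 ^ r - 1 :: nat)) r = choice a b (\<lambda>_. True) r"
      by (rule choice_cong) (use all_bits_iff[of "2 ^ r - 1" r] in simp)
    ultimately show "(t (choice a b (\<lambda>_. True) r @ a r), t (choice a b (\<lambda>_. True) r @ b r))
        \<in> top_forks"
      using lower[of "2 ^ r - 1"] upper[of "2 ^ r - 1"] by simp
  qed
  then show ?thesis
    using r by simp
qed

section \<open>All commutators read off from \<Delta>\<close>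

theorem commutator_eq_top_forks: "commutator A F n \<alpha> = top_forks"
  unfolding commutator_def
  using congruence_top_forks centralizes_top_forks top_forks_least by blast

text \<open>The commutator of \<open>I\<close> is computed in a cube of dimension
  \<open>card I\<close>. Reindexing in both directions identifies its top forks with the forks on
  \<open>I\<close> in the \<open>n\<close>-cube.\<close>

theorem commutator_on_eq_forks:
  assumes "I \<noteq> {}" and "I \<subseteq> {..<n}"
  shows "commutator_on A F I \<alpha> = {(x, y). cube_rel A F n \<alpha> (fork I x y)}"
proof -
  define m where "m = card I"
  define xs where "xs = sorted_list_of_set I"
  define \<beta> where "\<beta> j = \<alpha> (xs ! j)" for j
  have "finite I"
    using assms(2) finite_subset by blast
  then have xs: "set xs = I" "distinct xs" "length xs = m"
    by (auto simp: xs_def m_def)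
  have xs_less: "xs ! j < n" if "j < m" for j
    using that assms(2) xs nth_mem by blast
  have all_I: "(\<forall>i\<in>I. P i) \<longleftrightarrow> (\<forall>j<m. P (xs ! j))" for P
    using xs by (metis in_set_conv_nth)
  interpret face: malcev_congruences A F q m \<beta>
  proof unfold_locales
    show "1 \<le> m"
      using assms(1) \<open>finite I\<close> by (simp add: m_def Suc_le_eq card_gt_0_iff)
    show "\<forall>i<m. congruence A F (\<beta> i)"
      using congruences xs_less by (simp add: \<beta>_def)
  qed
  have "cube_rel A F n \<alpha> (fork I x y)" if "cube_rel A F m \<beta> (fork {..<m} x y)" for x y
  proof -
    \<comment> \<open>Projection of the \<open>n\<close>-cube onto the directions in
      \<open>I\<close>.\<close>
    let ?\<phi> = "\<lambda>k. of_bits m (\<lambda>j. bit k (xs ! j))"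
    have "cube_rel A F n \<alpha> (\<lambda>k. fork {..<m} x y (?\<phi> k))"
      using xs_less by (intro face.reindex[where \<beta> = \<alpha> and g = "fork {..<m} x y", OF n_pos \<alpha>_refl _ _ that]) (auto simp: \<beta>_def)
    moreover have "fork {..<m} x y (?\<phi> k) = fork I x y k" for k
      by (auto simp: fork_def all_I)
    ultimately show ?thesis
      by simp
  qed
  moreover have "cube_rel A F m \<beta> (fork {..<m} x y)" if "cube_rel A F n \<alpha> (fork I x y)" for x y
  proof -
    \<comment> \<open>Embedding of the \<open>m\<close>-cube as the face whose bits outside
      \<open>I\<close> are zero.\<close>
    let ?\<phi> = "\<lambda>k. of_bits n (\<lambda>i. \<exists>j<m. xs ! j = i \<and> bit k j)"
    have bit: "bit (?\<phi> k) (xs ! j) = bit k j" if "j < m" for k j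
      using that xs_less xs(2,3) by (auto simp: nth_eq_iff_index_eq)
    have "cube_rel A F m \<beta> (\<lambda>k. fork I x y (?\<phi> k))"
    proof (rule reindex[where \<beta> = \<beta> and g = "fork I x y", OF face.n_pos face.\<alpha>_refl _ _ that])
      fix i assume "i < n"
      show "(\<exists>j<m. \<alpha> i \<subseteq> \<beta> j \<and> (\<forall>k<2 ^ m. bit (?\<phi> k) i = bit k j)) \<or>
        (\<exists>c. \<forall>k<2 ^ m. bit (?\<phi> k) i = c)"
      proof (cases "i \<in> I")
        case True
        then obtain j where "j < m" "i = xs ! j"
          using xs by (metis in_set_conv_nth)
        then show ?thesis
          using bit by (auto simp: \<beta>_def simp del: bit_of_bits)
      next
        case False
        then have "\<not> bit (?\<phi> k) i" for k
          using xs nth_mem by auto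
        then show ?thesis
          by blast
      qed
    qed simp
    moreover have "fork I x y (?\<phi> k) = fork {..<m} x y k" for k
      using bit by (auto simp: fork_def all_I simp del: bit_of_bits)
    ultimately show ?thesis
      by simp
  qed
  moreover have "commutator_on A F I \<alpha> = commutator A F m \<beta>"
    by (simp add: commutator_on_def m_def \<beta>_def[abs_def] xs_def)
  ultimately show ?thesis
    unfolding face.commutator_eq_top_forks by (auto simp: face.top_forks_def)
qed

end

text \<open>
  In a Mal'cev algebra, \<open>\<Delta>\<close> is generated under \<open>q\<close> alone by the constants and the forks of the
  commutators: an element of \<open>\<Delta>\<close> can be approximated vertex by vertex.
\<close>

theorem Delta_mono_commutators:
  assumes "malcev_congruences A F q n \<alpha>" and "malcev_congruences A F' q n \<alpha>"
    and comm: "\<And>I. I \<noteq> {} \<Longrightarrow> I \<subseteq> {..<n} \<Longrightarrow> commutator_on A F I \<alpha> \<subseteq> commutator_on A F' I \<alpha>"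
  shows "Delta A F n \<alpha> \<subseteq> Delta A F' n \<alpha>"
proof
  interpret F: malcev_congruences A F q n \<alpha> by fact
  interpret F': malcev_congruences A F' q n \<alpha> by fact
  fix u assume u: "u \<in> Delta A F n \<alpha>"
  define v where "v = nth u"
  have v: "cube_rel A F n \<alpha> v"
    unfolding v_def by (rule cube_rel_nth[OF u])
  \<comment> \<open>The approximation \<open>w\<close> is kept in both relations: in that of
    \<open>F\<close> to extract the next fork, in that of \<open>F'\<close> to reach the
    conclusion.\<close>
  have "\<exists>w. cube_rel A F n \<alpha> w \<and> cube_rel A F' n \<alpha> w \<and> (\<forall>k\<le>p. w k = v k)" if "p < 2 ^ n" for p
    using that
  proof (induction p)
    case 0
    then show ?case
      using F.const F'.const F.in_carrier[OF v] by (intro exI[of _ "\<lambda>k. v 0"]) simp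
  next
    case (Suc p')
    define p where "p = Suc p'"
    obtain w where w: "cube_rel A F n \<alpha> w" "cube_rel A F' n \<alpha> w" "\<And>k. k < p \<Longrightarrow> w k = v k"
      using Suc by (auto simp: p_def less_Suc_eq_le)
    have p: "p < 2 ^ n"
      using Suc.prems by (simp add: p_def)
    define x y where "x = w p" and "y = v p"
    have in_A: "x \<in> A" "y \<in> A"
      using F.in_carrier[OF w(1) p] F.in_carrier[OF v p] by (auto simp: x_def y_def)
    define I where "I = {i. bit p i}"
    have I: "I \<subseteq> {..<n}"
      using bit_imp_less_exponent[OF p] by (auto simp: I_def)
    have "I \<noteq> {}"
      using bit_subset_imp_le[of p 0] by (auto simp: I_def p_def)
    \<comment> \<open>Intersection with the bits of \<open>p\<close>, a retraction of the cube onto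
      the face of vertices contained in \<open>p\<close>.\<close>
    let ?\<phi> = "\<lambda>k. of_bits n (\<lambda>i. bit p i \<and> bit k i)"
    have meet: "cube_rel A F n \<alpha> (\<lambda>k. g (?\<phi> k))" if "cube_rel A F n \<alpha> g" for g
    proof (rule F.reindex[where \<beta> = \<alpha> and g = g, OF F.n_pos F.\<alpha>_refl _ _ that])
      show "(\<exists>j<n. \<alpha> i \<subseteq> \<alpha> j \<and> (\<forall>k<2 ^ n. bit (?\<phi> k) i = bit k j)) \<or>
        (\<exists>c. \<forall>k<2 ^ n. bit (?\<phi> k) i = c)" if "i < n" for i
        using that by (cases "bit p i") auto
    qed simp
    \<comment> \<open>Vertices containing \<open>I\<close> are sent to \<open>p\<close>, giving
      \<open>q [y, x, x] = y\<close>. All others are sent below \<open>p\<close>, where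
      \<open>v\<close> and \<open>w\<close> agree, giving \<open>x\<close>.\<close>
    have "cube_rel A F n \<alpha> (\<lambda>k. q [v (?\<phi> k), w (?\<phi> k), x])"
      using meet[OF v] meet[OF w(1)] F.const[OF in_A(1)] by (rule F.q_closed)
    moreover have "q [v (?\<phi> k), w (?\<phi> k), x] = fork I x y k" for k
    proof (cases "\<forall>i\<in>I. bit k i")
      case True
      then have "?\<phi> k = p"
        using bit_imp_less_exponent[OF p] by (intro bit_eqI) (auto simp: I_def)
      then show ?thesis
        using True in_A by (simp add: fork_def x_def y_def)
    next
      case False
      then have "?\<phi> k \<noteq> p"
        by (auto simp: I_def) (metis bit_of_bits)
      moreover have "?\<phi> k \<le> p"
        by (rule bit_subset_imp_le) simp
      ultimately have "w (?\<phi> k) = v (?\<phi> k)"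
        by (intro w(3)) simp
      then show ?thesis
        using False in_A F.in_carrier[OF v, of "?\<phi> k"] by (auto simp: fork_def)
    qed
    ultimately have fork: "cube_rel A F n \<alpha> (fork I x y)"
      by simp
    \<comment> \<open>Here, and only here, the inclusion of commutators carries information from
      \<open>F\<close> to \<open>F'\<close>.\<close>
    then have fork': "cube_rel A F' n \<alpha> (fork I x y)"
      using comm[OF \<open>I \<noteq> {}\<close> I] F.commutator_on_eq_forks[OF \<open>I \<noteq> {}\<close> I]
        F'.commutator_on_eq_forks[OF \<open>I \<noteq> {}\<close> I] by auto
    \<comment> \<open>The fork is \<open>x\<close> below \<open>p\<close>, so earlier values
      survive; at \<open>p\<close> the result is \<open>q [y, x, x] = y\<close>.\<close>
    let ?w = "\<lambda>k. q [fork I x y k, x, w k]"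
    have "?w k = v k" if "k \<le> p" for k
    proof (cases "k = p")
      case True
      then show ?thesis
        using in_A by (simp add: fork_def I_def x_def[symmetric] y_def[symmetric])
    next
      case False
      with that have "k < p" by simp
      then have "fork I x y k = x"
        using bit_subset_imp_le[of p k] by (auto simp: fork_def I_def)
      then show ?thesis
        using \<open>k < p\<close> p w(3) in_A F.in_carrier[OF v, of k] by simp
    qed
    moreover have "cube_rel A F n \<alpha> ?w"
      using fork F.const[OF in_A(1)] w(1) by (rule F.q_closed)
    moreover have "cube_rel A F' n \<alpha> ?w"
      using fork' F'.const[OF in_A(1)] w(2) by (rule F'.q_closed)
    ultimately show ?case
      unfolding p_def by blast
  qed
  from this[of "2 ^ n - 1"] obtain w where "cube_rel A F' n \<alpha> w" "\<forall>k\<le>2 ^ n - 1. w k = v k"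
    by auto
  then have "cube_rel A F' n \<alpha> v"
    by (elim cube_rel_cong) (metis Suc_pred' less_Suc_eq_le zero_less_power zero_less_numeral)
  moreover have "map v [0..<2 ^ n] = u"
    using Delta_length[OF u] by (metis v_def map_nth)
  ultimately show "u \<in> Delta A F' n \<alpha>"
    by simp
qed


section \<open>The largest clone\<close>

lemma Pol_iff:
  "(N, f) \<in> Pol A n (Delta A F n \<alpha>) \<longleftrightarrow> 1 \<le> N \<and> op_on A N f \<and>
    (\<forall>gs. length gs = N \<and> (\<forall>g \<in> set gs. cube_rel A F n \<alpha> g) \<longrightarrow>
      cube_rel A F n \<alpha> (\<lambda>k. f (map (\<lambda>g. g k) gs)))"
    (is "_ \<longleftrightarrow> _ \<and> _ \<and> ?R")
proof -
  have "?R" if *: "\<forall>vs. length vs = N \<and> set vs \<subseteq> Delta A F n \<alpha> \<longrightarrow>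
      cube_rel A F n \<alpha> (\<lambda>j. f (map (\<lambda>v. v ! j) vs))"
  proof (intro allI impI, elim conjE)
    fix gs assume "length gs = N" "\<forall>g \<in> set gs. cube_rel A F n \<alpha> g"
    then have "cube_rel A F n \<alpha> (\<lambda>j. f (map (\<lambda>v. v ! j) (map (\<lambda>g. map g [0..<2 ^ n]) gs)))"
      by (intro *[rule_format]) auto
    then show "cube_rel A F n \<alpha> (\<lambda>k. f (map (\<lambda>g. g k) gs))"
      by (rule cube_rel_cong) (simp add: comp_def)
  qed
  moreover have "cube_rel A F n \<alpha> (\<lambda>j. f (map (\<lambda>v. v ! j) vs))"
    if "?R" "length vs = N" "set vs \<subseteq> Delta A F n \<alpha>" for vs
  proof -
    have "cube_rel A F n \<alpha> (\<lambda>j. f (map (\<lambda>g. g j) (map nth vs)))"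
      using that(2,3) by (intro that(1)[rule_format]) (auto intro!: cube_rel_nth)
    then show ?thesis
      by (simp add: comp_def)
  qed
  ultimately show ?thesis
    unfolding Pol_def by auto
qed

lemma Pol_app:
  assumes "(N, f) \<in> Pol A n (Delta A F n \<alpha>)" and "length gs = N"
    and "\<forall>g \<in> set gs. cube_rel A F n \<alpha> g"
  shows "cube_rel A F n \<alpha> (\<lambda>k. f (map (\<lambda>g. g k) gs))"
  using assms unfolding Pol_iff by blast

text \<open>\<Delta> is a subuniverse, hence closed under term operations. Applied to a competing
  clone instead of \<open>F\<close>, this yields maximality.\<close>

lemma term_ops_subset_Pol:
  assumes "algebra A F" and "\<forall>i<n. \<alpha> i \<subseteq> A \<times> A"
  shows "term_ops A F \<subseteq> Pol A n (Delta A F n \<alpha>)"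
proof clarify
  fix N t assume t: "(N, t) \<in> term_ops A F"
  have "1 \<le> N"
    using t by cases auto
  then show "(N, t) \<in> Pol A n (Delta A F n \<alpha>)"
    using term_ops_op_on[OF assms(1) t] cube_rel_term_op[OF assms t] by (simp add: Pol_iff)
qed

lemma op_on_compose:
  assumes "op_on A k f" and "length gs = k" and "\<forall>g \<in> set gs. op_on A m g"
  shows "op_on A m (compose A m f gs)"
proof -
  have "f (map (\<lambda>g. g xs) gs) \<in> A" if "length xs = m" "set xs \<subseteq> A" for xs
  proof -
    have "set (map (\<lambda>g. g xs) gs) \<subseteq> A"
      using assms(3) that by (auto simp: op_on_def)
    then show ?thesis
      using assms(1,2) by (simp add: op_on_def)
  qed
  then show ?thesis
    by (auto simp: op_on_def compose_def)
qed

lemma is_clone_Pol: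
  assumes "algebra A F" and "\<forall>i<n. \<alpha> i \<subseteq> A \<times> A"
  shows "is_clone A (Pol A n (Delta A F n \<alpha>))" (is "is_clone A ?P")
  unfolding is_clone_def
proof (intro conjI allI impI)
  show "\<forall>(m, f)\<in>?P. 1 \<le> m \<and> op_on A m f"
    by (auto simp: Pol_iff)
  show "(m, proj A m i) \<in> ?P" if "1 \<le> m \<and> i < m" for m i
    using that term_ops_subset_Pol[OF assms] proj_in by blast
  fix k f m gs
  assume "(k, f) \<in> ?P \<and> length gs = k \<and> 1 \<le> m \<and> (\<forall>g\<in>set gs. (m, g) \<in> ?P)"
  then have f: "(k, f) \<in> ?P" and len: "length gs = k" and m: "1 \<le> m"
    and gs: "\<forall>g\<in>set gs. (m, g) \<in> ?P"
    by auto
  have "cube_rel A F n \<alpha> (\<lambda>l. compose A m f gs (map (\<lambda>h. h l) hs))"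
    if hs: "length hs = m" "\<forall>h \<in> set hs. cube_rel A F n \<alpha> h" for hs
  proof -
    have "cube_rel A F n \<alpha> (\<lambda>l. f (map (\<lambda>g. g l) (map (\<lambda>g l. g (map (\<lambda>h. h l) hs)) gs)))"
      using gs len hs by (intro Pol_app[OF f]) (auto intro: Pol_app)
    moreover have "set (map (\<lambda>h. h l) hs) \<subseteq> A" if "l < 2 ^ n" for l
      using cube_rel_in_carrier[OF assms] hs(2) that by auto
    ultimately show ?thesis
      by (elim cube_rel_cong) (use hs(1) in \<open>simp add: compose_def comp_def\<close>)
  qed
  moreover have "op_on A m (compose A m f gs)"
    using f gs len by (intro op_on_compose) (auto simp: Pol_iff)
  ultimately show "(m, compose A m f gs) \<in> ?P"
    using m by (simp add: Pol_iff)
qed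

lemma clone_algebra:
  assumes "A \<noteq> {}" and "is_clone A C"
  shows "algebra A C"
  using assms by (fastforce simp: algebra_def is_clone_def op_on_def)

lemma clone_subset_term_ops:
  assumes "is_clone A C"
  shows "C \<subseteq> term_ops A C"
  using assms by (auto simp: is_clone_def intro!: basic_op_in_term_ops)

section \<open>Polymorphisms of \<Delta> in the Mal'cev setting\<close>

context malcev_congruences
begin

lemma clone_malcev_congruences:
  assumes "is_clone A C" and "(3, q) \<in> C" and "\<forall>(k, f)\<in>C. \<forall>i<n. preserves k f (\<alpha> i)"
  shows "malcev_congruences A C q n \<alpha>"
proof unfold_locales
  show "algebra A C"
    using algebra assms(1) by (intro clone_algebra) (auto simp: algebra_def)
  show "(3, q) \<in> term_ops A C"
    using assms(1,2) clone_subset_term_ops by blast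
  show "\<forall>i<n. congruence A C (\<alpha> i)"
    using congruences assms(3) by (auto simp: congruence_def)
qed (use malcev n_pos in auto)

text \<open>The vertices \<open>0\<close> and \<open>2 ^ i\<close> differ in bit \<open>i\<close>
  only, so generators in other directions agree there.\<close>

lemma edge_in_\<alpha>:
  assumes "i < n" and "cube_rel A F n \<alpha> g"
  shows "(g 0, g (2 ^ i)) \<in> \<alpha> i"
  using assms(2)
proof (induction rule: cube_rel_induct)
  case (gen j a b)
  have "congruence A F (\<alpha> i)" "a \<in> A"
    using gen congruences \<alpha>_subset assms(1) by auto
  then show ?case
    using gen congruence_refl by (auto simp: bit_exp_iff)
next
  case (app f gs)
  moreover have "preserves (length gs) f (\<alpha> i)"
    using app(1) congruences assms(1) by (auto simp: congruence_def)
  ultimately show ?case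
    by (auto simp: preserves_def list_all2_conv_all_nth)
next
  case (cong g h)
  then show ?case
    using assms(1) by simp
qed

text \<open>Pairs of \<open>\<alpha> i\<close> lift to generators in direction \<open>i\<close>, and
  the image pair is read off along the edge from \<open>0\<close> to \<open>2 ^ i\<close>.\<close>

lemma Pol_preserves_\<alpha>:
  assumes "(k, f) \<in> Pol A n (Delta A F n \<alpha>)" and "i < n"
  shows "preserves k f (\<alpha> i)"
  unfolding preserves_def
proof (intro allI impI, elim conjE)
  fix xs ys
  assume *: "length xs = k" "length ys = k" "list_all2 (\<lambda>x y. (x, y) \<in> \<alpha> i) xs ys"
  let ?gs = "map2 (\<lambda>x y (k::nat). if bit k i then y else x) xs ys"
  have "\<forall>g\<in>set ?gs. cube_rel A F n \<alpha> g"
    using * assms(2) by (auto simp: list_all2_iff intro!: cube_rel_gen)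
  then have "cube_rel A F n \<alpha> (\<lambda>k. f (map (\<lambda>g. g k) ?gs))"
    using * by (intro Pol_app[OF assms(1)]) auto
  from edge_in_\<alpha>[OF assms(2) this] have "(f (map (\<lambda>g. g 0) ?gs), f (map (\<lambda>g. g (2 ^ i)) ?gs)) \<in> \<alpha> i" .
  moreover have "map (\<lambda>g. g 0) ?gs = xs" "map (\<lambda>g. g (2 ^ i)) ?gs = ys"
    using * by (auto intro!: nth_equalityI simp: bit_exp_iff)
  ultimately show "(f xs, f ys) \<in> \<alpha> i"
    by (simp only:)
qed

text \<open>Polymorphisms generate nothing outside \<Delta>. For the converse, tuples are written as
  term operations applied to generators, because members of \<open>F\<close> may be nullary or not
  canonical and so lie outside \<open>Pol\<close>.\<close>

lemma Delta_Pol: "Delta A (Pol A n (Delta A F n \<alpha>)) n \<alpha> = Delta A F n \<alpha>" (is "Delta A ?P n \<alpha> = _")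
proof
  show "Delta A ?P n \<alpha> \<subseteq> Delta A F n \<alpha>"
  proof
    fix v assume "v \<in> Delta A ?P n \<alpha>"
    then show "v \<in> Delta A F n \<alpha>"
    proof induction
      case (gen i a b)
      then show ?case by (rule Delta.gen)
    next
      case (app k f vs)
      then show ?case by (auto simp: Pol_def subset_iff)
    qed
  qed
  show "Delta A F n \<alpha> \<subseteq> Delta A ?P n \<alpha>"
  proof
    fix v assume v: "v \<in> Delta A F n \<alpha>"
    obtain S where S: "finite S" "S \<subseteq> Sigma {..<n} \<alpha>"
      and rep: "\<And>G. G \<noteq> [] \<Longrightarrow> S \<subseteq> set G \<Longrightarrow> set G \<subseteq> Sigma {..<n} \<alpha> \<Longrightarrow>
        \<exists>t. (length G, t) \<in> term_ops A F \<and>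
          (\<forall>k<2 ^ n. v ! k = t (map (\<lambda>(i, a, b). if bit k i then b else a) G))"
      using cube_rel_term_representation[OF cube_rel_nth[OF v] \<alpha>_subset] by auto
    obtain c where "c \<in> A"
      using algebra by (auto simp: algebra_def)
    obtain G where G: "set G = insert (0, c, c) S"
      using finite_list[of "insert (0, c, c) S"] S(1) by auto
    have "(c, c) \<in> \<alpha> 0"
      using \<alpha>_refl \<open>c \<in> A\<close> by blast
    then have G_sub: "set G \<subseteq> Sigma {..<n} \<alpha>"
      using G S(2) n_pos by auto
    then obtain t where t: "(length G, t) \<in> term_ops A F"
      and val: "\<forall>k<2 ^ n. v ! k = t (map (\<lambda>(i, a, b). if bit k i then b else a) G)"
      using rep[of G] G by (metis insert_not_empty set_empty subset_insertI)
    let ?gs = "map (\<lambda>(i, a, b) (k::nat). if bit k i then b else a) G"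
    have "(length ?gs, t) \<in> ?P"
      using t term_ops_subset_Pol[OF algebra \<alpha>_subset] by auto
    moreover have "\<forall>g\<in>set ?gs. cube_rel A ?P n \<alpha> g"
      using G_sub by (auto intro!: cube_rel_gen)
    ultimately have "cube_rel A ?P n \<alpha> (\<lambda>k. t (map (\<lambda>g. g k) ?gs))"
      by (rule cube_rel_app)
    then have "cube_rel A ?P n \<alpha> (nth v)"
      by (rule cube_rel_cong) (auto simp: val comp_def case_prod_unfold)
    then show "v \<in> Delta A ?P n \<alpha>"
      using Delta_length[OF v] by (metis map_nth)
  qed
qed

end

theorem mainTheorem2:
  fixes A :: "'a set" and F :: "'a operation set" and q :: "'a list \<Rightarrow> 'a"
    and n :: nat and \<alpha> :: "nat \<Rightarrow> ('a \<times> 'a) set"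
  assumes "algebra A F"
    and "(3, q) \<in> term_ops A F"
    and "\<forall>x \<in> A. \<forall>y \<in> A. q [x, x, y] = y \<and> q [y, x, x] = y"
    and "1 \<le> n"
    and "\<forall>i < n. congruence A F (\<alpha> i)"
  shows "let good = (\<lambda>C. is_clone A C \<and> (3, q) \<in> C \<and>
                      (\<forall>(k, f) \<in> C. \<forall>i < n. preserves k f (\<alpha> i)) \<and>
                      (\<forall>I. I \<noteq> {} \<and> I \<subseteq> {..<n} \<longrightarrow>
                           commutator_on A F I \<alpha> = commutator_on A C I \<alpha>));
             P = Pol A n (Delta A F n \<alpha>)
         in good P \<and> (\<forall>C. good C \<longrightarrow> C \<subseteq> P)"
proof -
  interpret malcev_congruences A F q n \<alpha>
    using assms by unfold_locales auto
  let ?P = "Pol A n (Delta A F n \<alpha>)"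
  have clone_P: "is_clone A ?P"
    by (rule is_clone_Pol[OF algebra \<alpha>_subset])
  have q_P: "(3, q) \<in> ?P"
    using q_term term_ops_subset_Pol[OF algebra \<alpha>_subset] by blast
  have preserves_P: "\<forall>(k, f) \<in> ?P. \<forall>i<n. preserves k f (\<alpha> i)"
    using Pol_preserves_\<alpha> by auto
  interpret P: malcev_congruences A ?P q n \<alpha>
    by (rule clone_malcev_congruences[OF clone_P q_P preserves_P])
  \<comment> \<open>Both commutators are given by forks in the same relation \<Delta>.\<close>
  have commutators_P: "commutator_on A F I \<alpha> = commutator_on A ?P I \<alpha>"
    if "I \<noteq> {}" "I \<subseteq> {..<n}" for I
    using commutator_on_eq_forks[OF that] P.commutator_on_eq_forks[OF that] by (simp add: Delta_Pol)
  have maximal: "C \<subseteq> ?P"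
    if clone: "is_clone A C" and q: "(3, q) \<in> C"
      and pres: "\<forall>(k, f) \<in> C. \<forall>i<n. preserves k f (\<alpha> i)"
      and comm: "\<forall>I. I \<noteq> {} \<and> I \<subseteq> {..<n} \<longrightarrow> commutator_on A F I \<alpha> = commutator_on A C I \<alpha>"
    for C
  proof -
    interpret C: malcev_congruences A C q n \<alpha>
      by (rule clone_malcev_congruences[OF clone q pres])
    \<comment> \<open>Equal commutators give both inclusions, so \<open>C\<close> preserves \<Delta>
      of the original algebra.\<close>
    have "Delta A F n \<alpha> = Delta A C n \<alpha>"
      using comm
      by (intro equalityI Delta_mono_commutators[where q = q]
            malcev_congruences_axioms C.malcev_congruences_axioms) auto
    then show ?thesis
      using clone_subset_term_ops[OF clone] term_ops_subset_Pol[OF C.algebra \<alpha>_subset] by auto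
  qed
  show ?thesis
    unfolding Let_def
  proof (intro conjI allI impI)
    show "is_clone A ?P" "(3, q) \<in> ?P" "\<forall>(k, f) \<in> ?P. \<forall>i<n. preserves k f (\<alpha> i)"
      by (fact clone_P q_P preserves_P)+
  qed (elim conjE; rule commutators_P maximal; assumption)+
qed

end
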